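(* Let $n=2$ with dependent variables $(u^1,u^2)=(u,v)$, let $f=u\partial_u-v\partial_v$, i.e. $(f^1,f^2)=(u,-v)$, and let $$A=\begin{pmatrix}0&1\\1&0\end{pmatrix}\partial_x,\qquad B^{ij}=g^{ij}\partial_x+\Gamma^{ij}_ku^k_x+\kappa f^i\partial_x^{-1}f^j$$ be a bi-Hamiltonian pair, where $\kappa\neq0$ is a constant, $g^{ij}=g^{ij}(u,v)$ and $\det(g^{ij})\neq0$. Then the metric $g^{ij}$ is one of the following (canonical forms, parameters having been reduced by translations and scalings of the dependent variables): $$g_7^{ij}=\begin{pmatrix}\frac{\alpha uv+\epsilon}{v^2}&\beta\\ \beta&0\end{pmatrix},\ \beta\neq0;\qquad g_8^{ij}=\begin{pmatrix}\frac{u}{v}&\beta\\ \beta&\frac{\alpha v}{u}\end{pmatrix},\ \alpha\neq\beta^2;\qquad g_9^{ij}=\begin{pmatrix}\frac{\alpha}{F}&\beta\\ \beta&F\end{pmatrix},\ \alpha\neq\beta^2,$$ with $$F=\frac{\gamma uv+\epsilon+\sqrt{(\gamma^2-4\alpha)u^2v^2+2\gamma\epsilon uv+\epsilon^2}}{2u^2},$$ where $\alpha,\beta,\gamma,\epsilon$ are constants.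
   Context: Write $\eta=(\eta^{ij})=\begin{pmatrix}0&1\\1&0\end{pmatrix}$ for the leading coefficient of $A$. Hamiltonian operators. An operator $g^{ij}\partial_x+\Gamma^{ij}_k u^k_x$ with $\det(g^{ij})\neq0$ is Hamiltonian if and only if $g^{ij}$ is symmetric, its inverse $g_{ij}$ is a flat pseudo-Riemannian metric, and $\Gamma^{ij}_k=-g^{is}\Gamma^j_{sk}$ with $\Gamma^j_{sk}$ the Christoffel symbols of the Levi-Civita connection of $g_{ij}$. For $n=2$, an operator $g^{ij}\partial_x+\Gamma^{ij}_ku^k_x+\kappa f^i\partial_x^{-1}f^j$ with $\kappa\neq 0$ is Hamiltonian if and only if its local part is Hamiltonian and $f$ is an infinitesimal isometry (Killing vector field) of $g$. Bi-Hamiltonian pair. $A$ and $B$ form a bi-Hamiltonian pair if $B+\lambda A$ is Hamiltonian for every $\lambda$. Equivalently: $f$ is an infinitesimal isometry of both $\eta$ and $g$; the contravariant Christoffel symbols $\Gamma^{ij}_k$ of $g^{ij}+\lambda\eta^{ij}$ are independent of $\lambda$; and $g^{ij}+\lambda\eta^{ij}$ is flat for every $\lambda$. Convention of the classification. The classification is made with respect to local changes of the dependent variables. Flat coordinates and linear transformations have been used to bring $A$ to the form $\eta^{ij}\partial_x$ above; the only remaining coordinate freedom consists of translations and scalings of the dependent variables, and it is used to reduce the number of parameters in the canonical forms.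
   Formalization: The square root in F is read as a smooth branch of either sign: with the nonnegative real root alone the list misses e.g. the metric with g^{11}=0, g^{12}=1, g^{22}=-1/u^2, which satisfies all hypotheses. *)

theory Defs
  imports "HOL-Analysis.Analysis"
begin

section \<open>Partial derivatives and smoothness\<close>

definition pd :: "'n::finite \<Rightarrow> (real^'n \<Rightarrow> real) \<Rightarrow> real^'n \<Rightarrow> real" where
  "pd k \<phi> x = frechet_derivative \<phi> (at x) (axis k 1)"

primrec Ck_on :: "nat \<Rightarrow> (real^'n::finite) set \<Rightarrow> (real^'n \<Rightarrow> real) \<Rightarrow> bool" where
  "Ck_on 0 U \<phi> \<longleftrightarrow> continuous_on U \<phi>"
| "Ck_on (Suc m) U \<phi> \<longleftrightarrow> (\<forall>x\<in>U. \<phi> differentiable (at x)) \<and> (\<forall>k. Ck_on m U (pd k \<phi>))"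

text \<open>Meant for open \<open>U\<close> only.\<close>
definition smooth_on :: "(real^'n::finite) set \<Rightarrow> (real^'n \<Rightarrow> real) \<Rightarrow> bool" where
  "smooth_on U \<phi> \<longleftrightarrow> (\<forall>m. Ck_on m U \<phi>)"


section \<open>Pseudo-Riemannian geometry of a contravariant metric\<close>

text \<open>A metric is given by its contravariant components: \<open>g x $ i $ j\<close> is \<open>g\<^sup>i\<^sup>j(x)\<close>.
  The usual metric tensor with lower indices is the matrix inverse.\<close>

definition cov :: "(real^'n::finite \<Rightarrow> real^'n^'n) \<Rightarrow> 'n \<Rightarrow> 'n \<Rightarrow> real^'n \<Rightarrow> real" where
  "cov g i j x = matrix_inv (g x) $ i $ j"

text \<open>\<open>christoffel g j s k\<close> is the Levi-Civita symbol with upper index \<open>j\<close> and lower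
  indices \<open>s\<close>, \<open>k\<close>.\<close>

definition christoffel ::
    "(real^'n::finite \<Rightarrow> real^'n^'n) \<Rightarrow> 'n \<Rightarrow> 'n \<Rightarrow> 'n \<Rightarrow> real^'n \<Rightarrow> real" where
  "christoffel g j s k x =
     (1/2) * (\<Sum>l\<in>UNIV. g x $ j $ l *
       (pd s (cov g l k) x + pd k (cov g l s) x - pd l (cov g s k) x))"

definition riemann ::
    "(real^'n::finite \<Rightarrow> real^'n^'n) \<Rightarrow> 'n \<Rightarrow> 'n \<Rightarrow> 'n \<Rightarrow> 'n \<Rightarrow> real^'n \<Rightarrow> real" where
  "riemann g i j k l x =
     pd k (christoffel g i l j) x - pd l (christoffel g i k j) x
     + (\<Sum>m\<in>UNIV. christoffel g i k m x * christoffel g m l j x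
                 - christoffel g i l m x * christoffel g m k j x)"

definition flat_on :: "(real^'n::finite) set \<Rightarrow> (real^'n \<Rightarrow> real^'n^'n) \<Rightarrow> bool" where
  "flat_on U g \<longleftrightarrow> (\<forall>x\<in>U. \<forall>i j k l. riemann g i j k l x = 0)"

text \<open>The Lie derivative of the metric tensor along \<open>f\<close> vanishes.\<close>

definition killing_on ::
    "(real^'n::finite) set \<Rightarrow> (real^'n \<Rightarrow> real^'n^'n) \<Rightarrow> (real^'n \<Rightarrow> real^'n) \<Rightarrow> bool" where
  "killing_on U g f \<longleftrightarrow>
     (\<forall>x\<in>U. \<forall>i j.
        (\<Sum>s\<in>UNIV. f x $ s * pd s (cov g i j) x
                   + cov g s j x * pd i (\<lambda>y. f y $ s) x
                   + cov g i s x * pd j (\<lambda>y. f y $ s) x) = 0)"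


section \<open>Operators of hydrodynamic type\<close>

text \<open>A \<open>local_op\<close> stands for \<open>g\<^sup>i\<^sup>j \<partial>\<^sub>x + \<Gamma>\<^sup>i\<^sup>j\<^sub>k u\<^sup>k\<^sub>x\<close>, with \<open>lead P x $ i $ j = g\<^sup>i\<^sup>j(x)\<close> and
  \<open>conn P i j k x = \<Gamma>\<^sup>i\<^sup>j\<^sub>k(x)\<close>; a \<open>nonlocal_op\<close> has the additional term
  \<open>\<kappa> f\<^sup>i \<partial>\<^sub>x\<^sup>-\<^sup>1 f\<^sup>j\<close>. Operators are identified with their coefficients.\<close>

record ('n::finite) local_op =
  lead :: "real^'n \<Rightarrow> real^'n^'n"
  conn :: "'n \<Rightarrow> 'n \<Rightarrow> 'n \<Rightarrow> real^'n \<Rightarrow> real"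

record ('n::finite) nonlocal_op = "'n local_op" +
  kap :: real
  tail :: "real^'n \<Rightarrow> real^'n"

text \<open>The Hamiltonian property is expressed by the Dubrovin--Novikov criterion for local
  operators and, for two components, by its extension to operators with the above nonlocal
  term. Both are criteria for nondegenerate operators.\<close>

definition local_hamiltonian_on ::
    "(real^'n::finite) set \<Rightarrow> ('n, 'z) local_op_scheme \<Rightarrow> bool" where
  "local_hamiltonian_on U P \<longleftrightarrow>
     (\<forall>x\<in>U. det (lead P x) \<noteq> 0) \<and>
     (\<forall>x\<in>U. transpose (lead P x) = lead P x) \<and>
     flat_on U (lead P) \<and>
     (\<forall>x\<in>U. \<forall>i j k.
        conn P i j k x = - (\<Sum>s\<in>UNIV. lead P x $ i $ s * christoffel (lead P) j s k x))"

definition hamiltonian_on :: "(real^2) set \<Rightarrow> 2 nonlocal_op \<Rightarrow> bool" where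
  "hamiltonian_on U P \<longleftrightarrow>
     local_hamiltonian_on U P \<and> (kap P \<noteq> 0 \<longrightarrow> killing_on U (lead P) (tail P))"

text \<open>The operator \<open>B + t A\<close>.\<close>

definition pencil ::
    "'n::finite local_op \<Rightarrow> 'n nonlocal_op \<Rightarrow> real \<Rightarrow> 'n nonlocal_op" where
  "pencil A B t =
     B\<lparr>lead := \<lambda>x. lead B x + t *\<^sub>R lead A x,
       conn := \<lambda>i j k x. conn B i j k x + t * conn A i j k x\<rparr>"

text \<open>Individual members of the pencil may degenerate at some points, or even identically
  (for \<open>g = \<beta>\<eta>\<close> at \<open>t = -\<beta>\<close>). Each member is therefore required to be Hamiltonian on the open
  set where it is nondegenerate; every point lies in this set for all but finitely many
  \<open>t\<close> whenever \<open>A\<close> is nondegenerate.\<close>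

definition bihamiltonian_on ::
    "(real^2) set \<Rightarrow> 2 local_op \<Rightarrow> 2 nonlocal_op \<Rightarrow> bool" where
  "bihamiltonian_on U A B \<longleftrightarrow>
     (\<forall>t. hamiltonian_on {x\<in>U. det (lead (pencil A B t) x) \<noteq> 0} (pencil A B t))"

definition A_op :: "2 local_op" where
  "A_op = \<lparr>lead = \<lambda>_. vector [vector [0, 1], vector [1, 0]], conn = \<lambda>_ _ _ _. 0\<rparr>"

definition hyp_rot :: "real^2 \<Rightarrow> real^2" where
  "hyp_rot x = vector [x$1, - x$2]"


section \<open>Scalings of the dependent variables\<close>

definition rescale :: "real^'n::finite \<Rightarrow> real^'n \<Rightarrow> real^'n" where
  "rescale c x = (\<chi> i. c$i * x$i)"

text \<open>Components of the metric in the new variables \<open>y = rescale c x\<close>.\<close>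

definition rescale_metric ::
    "real^'n::finite \<Rightarrow> (real^'n \<Rightarrow> real^'n^'n) \<Rightarrow> real^'n \<Rightarrow> real^'n^'n" where
  "rescale_metric c g y = (\<chi> i j. c$i * c$j * g (\<chi> k. y$k / c$k) $ i $ j)"


section \<open>Canonical forms\<close>

definition g7 :: "real \<Rightarrow> real \<Rightarrow> real \<Rightarrow> real^2 \<Rightarrow> real^2^2" where
  "g7 \<alpha> \<beta> \<epsilon> x = (let u = x$1; v = x$2 in
     vector [vector [(\<alpha> * u * v + \<epsilon>) / v^2, \<beta>], vector [\<beta>, 0]])"

definition g8 :: "real \<Rightarrow> real \<Rightarrow> real^2 \<Rightarrow> real^2^2" where
  "g8 \<alpha> \<beta> x = (let u = x$1; v = x$2 in
     vector [vector [u / v, \<beta>], vector [\<beta>, \<alpha> * v / u]])"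

definition radicand :: "real \<Rightarrow> real \<Rightarrow> real \<Rightarrow> real^2 \<Rightarrow> real" where
  "radicand \<alpha> \<gamma> \<epsilon> x = (let u = x$1; v = x$2 in
     (\<gamma>^2 - 4 * \<alpha>) * u^2 * v^2 + 2 * \<gamma> * \<epsilon> * u * v + \<epsilon>^2)"

text \<open>The square root in \<open>F\<close> is a smooth branch \<open>R\<close>, not necessarily the nonnegative one.
  With the nonnegative root alone the list would be incomplete: for \<open>\<alpha> = 0\<close> the metric
  with \<open>g\<^sup>1\<^sup>1 = 0\<close>, \<open>g\<^sup>2\<^sup>2 = (\<gamma> u v + \<epsilon>) / u\<^sup>2\<close> needs the root \<open>R = \<gamma> u v + \<epsilon>\<close>, whatever its sign.\<close>

definition sqrt_branch_on :: "(real^2) set \<Rightarrow> (real^2 \<Rightarrow> real) \<Rightarrow> (real^2 \<Rightarrow> real) \<Rightarrow> bool" where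
  "sqrt_branch_on U D R \<longleftrightarrow> smooth_on U R \<and> (\<forall>x\<in>U. (R x)^2 = D x)"

definition F9 :: "real \<Rightarrow> real \<Rightarrow> (real^2 \<Rightarrow> real) \<Rightarrow> real^2 \<Rightarrow> real" where
  "F9 \<gamma> \<epsilon> R x = (let u = x$1; v = x$2 in (\<gamma> * u * v + \<epsilon> + R x) / (2 * u^2))"

text \<open>For \<open>\<alpha> \<noteq> 0\<close>, \<open>F\<close> has no zeros with \<open>u, v \<noteq> 0\<close>; for \<open>\<alpha> = 0\<close> the entry \<open>\<alpha> / F\<close> is \<open>0\<close>,
  also at zeros of \<open>F\<close>.\<close>

definition g9 :: "real \<Rightarrow> real \<Rightarrow> real \<Rightarrow> real \<Rightarrow> (real^2 \<Rightarrow> real) \<Rightarrow> real^2 \<Rightarrow> real^2^2" where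
  "g9 \<alpha> \<beta> \<gamma> \<epsilon> R x =
     vector [vector [\<alpha> / F9 \<gamma> \<epsilon> R x, \<beta>], vector [\<beta>, F9 \<gamma> \<epsilon> R x]]"

definition is_g7_on :: "(real^2) set \<Rightarrow> (real^2 \<Rightarrow> real^2^2) \<Rightarrow> bool" where
  "is_g7_on V G \<longleftrightarrow> (\<exists>\<alpha> \<beta> \<epsilon>. \<beta> \<noteq> 0 \<and> (\<forall>x\<in>V. x$2 \<noteq> 0 \<longrightarrow> G x = g7 \<alpha> \<beta> \<epsilon> x))"

definition is_g8_on :: "(real^2) set \<Rightarrow> (real^2 \<Rightarrow> real^2^2) \<Rightarrow> bool" where
  "is_g8_on V G \<longleftrightarrow> (\<exists>\<alpha> \<beta>. \<alpha> \<noteq> \<beta>^2 \<and> (\<forall>x\<in>V. x$1 \<noteq> 0 \<and> x$2 \<noteq> 0 \<longrightarrow> G x = g8 \<alpha> \<beta> x))"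

definition is_g9_on :: "(real^2) set \<Rightarrow> (real^2 \<Rightarrow> real^2^2) \<Rightarrow> bool" where
  "is_g9_on V G \<longleftrightarrow> (\<exists>\<alpha> \<beta> \<gamma> \<epsilon> R. \<alpha> \<noteq> \<beta>^2 \<and> sqrt_branch_on V (radicand \<alpha> \<gamma> \<epsilon>) R \<and>
     (\<forall>x\<in>V. x$1 \<noteq> 0 \<longrightarrow> G x = g9 \<alpha> \<beta> \<gamma> \<epsilon> R x))"

end

theory Submission imports Defs begin

text \<open>Write \<open>a, b, c\<close> for \<open>g\<^sup>1\<^sup>1, g\<^sup>1\<^sup>2, g\<^sup>2\<^sup>2\<close>. The metric \<open>g + t \<eta>\<close> has off-diagonal entry \<open>\<tau> = b + t\<close>, and
  its torsion and curvature identities, written with the \<open>t\<close>-independent contravariant symbols, are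
  polynomials in \<open>\<tau>\<close>; their coefficients are differential equations for \<open>a, b, c\<close>. Together with the
  Killing equations they force \<open>b\<close> and \<open>a c\<close> to be constants \<open>\<beta>\<close> and \<open>\<alpha>\<close>, and
  \<open>v\<^sup>2 a + u\<^sup>2 c = \<gamma> u v + \<epsilon>\<close>. So \<open>u\<^sup>2 c\<close> and \<open>v\<^sup>2 a\<close> are the two roots of a quadratic whose
  discriminant has the globally smooth square root \<open>R = u\<^sup>2 c - v\<^sup>2 a\<close>. This is \<open>g\<^sub>9\<close>, except when
  \<open>c = 0\<close>, which gives \<open>g\<^sub>7\<close>. The forms \<open>g\<^sub>8\<close> are thereby covered as well, and no rescaling
  is needed.\<close>

section \<open>Partial derivatives\<close>

lemma pd_eqI:
  assumes "(\<phi> has_derivative D) (at x)"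
  shows "pd k \<phi> x = D (axis k 1)"
  unfolding pd_def using frechet_derivative_at[OF assms] by simp

lemma pd_const [simp]: "pd k (\<lambda>_. c) x = 0"
  by (simp add: pd_def)

lemma pd_add:
  assumes "f differentiable (at x)" "g differentiable (at x)"
  shows "pd k (\<lambda>y. f y + g y) x = pd k f x + pd k g x"
  using pd_eqI[OF has_derivative_add[OF assms[unfolded frechet_derivative_works]]]
  by (simp add: pd_def)

lemma pd_diff:
  assumes "f differentiable (at x)" "g differentiable (at x)"
  shows "pd k (\<lambda>y. f y - g y) x = pd k f x - pd k g x"
  using pd_eqI[OF has_derivative_diff[OF assms[unfolded frechet_derivative_works]]]
  by (simp add: pd_def)

lemma pd_minus:
  assumes "f differentiable (at x)"
  shows "pd k (\<lambda>y. - f y) x = - pd k f x"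
  using pd_eqI[OF has_derivative_minus[OF assms[unfolded frechet_derivative_works]]]
  by (simp add: pd_def)

lemma pd_mult:
  assumes "f differentiable (at x)" "g differentiable (at x)"
  shows "pd k (\<lambda>y. f y * g y) x = pd k f x * g x + f x * pd k g x"
  using pd_eqI[OF has_derivative_mult[OF assms[unfolded frechet_derivative_works]]]
  by (simp add: pd_def)

lemma pd_divide_const:
  assumes "f differentiable (at x)"
  shows "pd k (\<lambda>y. f y / c) x = pd k f x / c"
  using pd_mult[of f x "\<lambda>_. 1 / c"] assms by simp

lemma differentiable_vec_nth [simp]:
  "(\<lambda>y::real^'n::finite. y $ i) differentiable (at x)"
  by (intro bounded_linear_imp_differentiable bounded_linear_vec_nth)

lemma pd_vec_nth: "pd k (\<lambda>y::real^'n::finite. y $ i) x = (if i = k then 1 else 0)"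
proof -
  have "((\<lambda>y::real^'n. y $ i) has_derivative (\<lambda>y. y $ i)) (at x)"
    by (rule bounded_linear_imp_has_derivative[OF bounded_linear_vec_nth])
  from pd_eqI[OF this] show ?thesis by (auto simp: axis_def)
qed

text \<open>Both sides are the same \<open>SOME\<close> choice, since the two functions have the
  same derivatives at \<open>x\<close>. So an identity valid on an open set can be differentiated
  without checking differentiability.\<close>

lemma pd_cong_open:
  assumes "open U" "x \<in> U" "\<And>y. y \<in> U \<Longrightarrow> f y = g y"
  shows "pd k f x = pd k g x"
proof -
  have "(f has_derivative D) (at x) \<longleftrightarrow> (g has_derivative D) (at x)" for D
    using has_derivative_transform_within_open[OF _ assms(1,2)] assms(3) by metis
  then show ?thesis
    by (simp add: pd_def frechet_derivative_def)
qed

lemma differentiable_cong_open: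
  assumes "open U" "x \<in> U" "\<And>y. y \<in> U \<Longrightarrow> f y = g y" "f differentiable (at x)"
  shows "g differentiable (at x)"
  using has_derivative_transform_within_open[OF _ assms(1,2)] assms(3,4)
  unfolding differentiable_def by metis

lemma pd_eq_0_imp_constant:
  fixes f :: "real^'n::finite \<Rightarrow> real"
  assumes "open U" "connected U" "\<And>x. x \<in> U \<Longrightarrow> f differentiable (at x)"
    and pd: "\<And>x k. x \<in> U \<Longrightarrow> pd k f x = 0"
  obtains c where "\<And>x. x \<in> U \<Longrightarrow> f x = c"
proof -
  have "(f has_derivative (\<lambda>_. 0)) (at x)" if x: "x \<in> U" for x
  proof -
    have D: "(f has_derivative frechet_derivative f (at x)) (at x)"
      using assms(3)[OF x] by (simp add: frechet_derivative_works)
    then have lin: "linear (frechet_derivative f (at x))"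
      by (rule has_derivative_linear)
    have "frechet_derivative f (at x) = (\<lambda>_. 0)"
    proof (rule linear_eq_stdbasis[OF lin])
      show "linear (\<lambda>_::real^'n. 0::real)" by (simp add: linear_iff)
      show "frechet_derivative f (at x) b = 0" if "b \<in> Basis" for b
        using that pd[OF x] by (auto simp: Basis_vec_def pd_def)
    qed
    with D show ?thesis by simp
  qed
  then have "f x = f (SOME y. y \<in> U)" if "x \<in> U" for x
    using has_derivative_zero_unique_connected[OF assms(1,2)] that by (metis someI)
  then show ?thesis using that by blast
qed

section \<open>Symmetry of mixed second partial derivatives\<close>

lemma pd_line:
  assumes "\<phi> differentiable (at (p + t *\<^sub>R axis k 1))"
  shows "((\<lambda>s. \<phi> (p + s *\<^sub>R axis k 1)) has_real_derivative pd k \<phi> (p + t *\<^sub>R axis k 1)) (at t)"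
proof -
  let ?D = "frechet_derivative \<phi> (at (p + t *\<^sub>R axis k 1))"
  have D: "(\<phi> has_derivative ?D) (at (p + t *\<^sub>R axis k 1))"
    using assms by (simp add: frechet_derivative_works)
  have "((\<lambda>s. \<phi> (p + s *\<^sub>R axis k 1)) has_derivative (\<lambda>s. ?D (s *\<^sub>R axis k 1))) (at t)"
    by (rule has_derivative_compose[where f = "\<lambda>s. p + s *\<^sub>R axis k 1" and g = \<phi>, OF _ D]) (auto intro!: derivative_eq_intros)
  moreover have "(\<lambda>s. ?D (s *\<^sub>R axis k 1)) = (*) (pd k \<phi> (p + t *\<^sub>R axis k 1))"
    using linear_scale[OF has_derivative_linear[OF D]] by (auto simp: pd_def fun_eq_iff)
  ultimately show ?thesis by (simp add: has_field_derivative_def)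
qed

text \<open>The mean value theorem applies twice: along \<open>axis i 1\<close> to the increment of
  \<open>\<phi>\<close> in direction \<open>j\<close>, then along \<open>axis j 1\<close> to
  \<open>pd i \<phi>\<close>.\<close>

lemma second_difference:
  fixes \<phi> :: "real^'n::finite \<Rightarrow> real"
  assumes "0 < h"
    and U: "\<And>s t. 0 \<le> s \<Longrightarrow> s \<le> h \<Longrightarrow> 0 \<le> t \<Longrightarrow> t \<le> h \<Longrightarrow> x + s *\<^sub>R axis i 1 + t *\<^sub>R axis j 1 \<in> U"
    and d1: "\<And>y. y \<in> U \<Longrightarrow> \<phi> differentiable (at y)"
    and d2: "\<And>y. y \<in> U \<Longrightarrow> pd i \<phi> differentiable (at y)"
  obtains s t where "0 < s" "s < h" "0 < t" "t < h"
    "\<phi> (x + h *\<^sub>R axis i 1 + h *\<^sub>R axis j 1) - \<phi> (x + h *\<^sub>R axis i 1) - \<phi> (x + h *\<^sub>R axis j 1) + \<phi> x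
       = h * h * pd j (pd i \<phi>) (x + s *\<^sub>R axis i 1 + t *\<^sub>R axis j 1)"
proof -
  let ?\<psi> = "\<lambda>s. \<phi> ((x + h *\<^sub>R axis j 1) + s *\<^sub>R axis i 1) - \<phi> (x + s *\<^sub>R axis i 1)"
  let ?\<psi>' = "\<lambda>s. pd i \<phi> ((x + h *\<^sub>R axis j 1) + s *\<^sub>R axis i 1) - pd i \<phi> (x + s *\<^sub>R axis i 1)"
  have "DERIV ?\<psi> s :> ?\<psi>' s" if "0 \<le> s" "s \<le> h" for s
  proof (intro DERIV_diff pd_line d1)
    show "x + h *\<^sub>R axis j 1 + s *\<^sub>R axis i 1 \<in> U" "x + s *\<^sub>R axis i 1 \<in> U"
      using U[OF that, of h] U[OF that, of 0] assms(1) by (simp_all add: algebra_simps)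
  qed
  from MVT2[OF \<open>0 < h\<close> this] obtain s where
    s: "0 < s" "s < h" "?\<psi> h - ?\<psi> 0 = (h - 0) * ?\<psi>' s" by auto
  let ?\<chi> = "\<lambda>t. pd i \<phi> ((x + s *\<^sub>R axis i 1) + t *\<^sub>R axis j 1)"
  have "DERIV ?\<chi> t :> pd j (pd i \<phi>) ((x + s *\<^sub>R axis i 1) + t *\<^sub>R axis j 1)"
    if "0 \<le> t" "t \<le> h" for t
    using s U[of s t] that by (intro pd_line d2) auto
  from MVT2[OF \<open>0 < h\<close> this] obtain t where
    t: "0 < t" "t < h"
      "?\<chi> h - ?\<chi> 0 = (h - 0) * pd j (pd i \<phi>) ((x + s *\<^sub>R axis i 1) + t *\<^sub>R axis j 1)" by auto
  have "?\<psi>' s = ?\<chi> h - ?\<chi> 0" by (simp add: algebra_simps)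
  then have "?\<psi> h - ?\<psi> 0 = h * h * pd j (pd i \<phi>) (x + s *\<^sub>R axis i 1 + t *\<^sub>R axis j 1)"
    using s t by simp
  then show ?thesis
    using that[OF s(1,2) t(1,2)] by (simp add: algebra_simps)
qed

text \<open>Schwarz's theorem. The second difference is symmetric in \<open>i\<close> and
  \<open>j\<close>, so the two mixed derivatives agree when taken at suitable points close to
  \<open>x\<close>; continuity at \<open>x\<close> then excludes different values.\<close>

lemma pd_commute:
  fixes \<phi> :: "real^'n::finite \<Rightarrow> real"
  assumes "open U" "x \<in> U"
    and d1: "\<And>y. y \<in> U \<Longrightarrow> \<phi> differentiable (at y)"
    and d2: "\<And>y k. y \<in> U \<Longrightarrow> pd k \<phi> differentiable (at y)"
    and cont: "\<And>k l. continuous_on U (pd k (pd l \<phi>))"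
  shows "pd i (pd j \<phi>) x = pd j (pd i \<phi>) x"
proof (rule ccontr)
  let ?p = "pd j (pd i \<phi>)" and ?q = "pd i (pd j \<phi>)"
  assume ne: "?q x \<noteq> ?p x"
  \<comment> \<open>Half the gap: a number within \<open>e\<close> of \<open>?p x\<close> cannot
    also be within \<open>e\<close> of \<open>?q x\<close>.\<close>
  define e where "e = \<bar>?q x - ?p x\<bar> / 2"
  have "e > 0" using ne by (simp add: e_def)
  have cc: "isCont ?p x" "isCont ?q x"
    using cont assms(1,2) continuous_on_eq_continuous_at by blast+
  obtain d0 where d0: "d0 > 0" "ball x d0 \<subseteq> U"
    using assms(1,2) open_contains_ball by blast
  obtain dp where dp: "dp > 0" "\<And>y. dist y x < dp \<Longrightarrow> dist (?p y) (?p x) < e"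
    using cc(1) \<open>e > 0\<close> unfolding continuous_at_eps_delta by blast
  obtain dq where dq: "dq > 0" "\<And>y. dist y x < dq \<Longrightarrow> dist (?q y) (?q x) < e"
    using cc(2) \<open>e > 0\<close> unfolding continuous_at_eps_delta by blast
  define d where "d = min d0 (min dp dq)"
  \<comment> \<open>Two axis steps of length at most \<open>h\<close> cover at most
    \<open>2 * d / 3\<close>.\<close>
  define h where "h = d / 3"
  have "h > 0" using d0 dp dq by (simp add: h_def d_def)
  have close: "dist (x + s *\<^sub>R axis k 1 + t *\<^sub>R axis l 1) x < d"
    if "0 \<le> s" "s \<le> h" "0 \<le> t" "t \<le> h" for s t k l
  proof -
    have "dist (x + s *\<^sub>R axis k 1 + t *\<^sub>R axis l 1) x = norm (s *\<^sub>R axis k (1::real) + t *\<^sub>R axis l 1)"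
      by (simp add: dist_norm add.assoc)
    also have "\<dots> \<le> norm (s *\<^sub>R axis k (1::real)) + norm (t *\<^sub>R axis l (1::real))"
      by (rule norm_triangle_ineq)
    also have "\<dots> = s + t" using that by simp
    also have "\<dots> < d" using that \<open>h > 0\<close> by (simp add: h_def)
    finally show ?thesis .
  qed
  then have inU: "x + s *\<^sub>R axis k 1 + t *\<^sub>R axis l 1 \<in> U"
    if "0 \<le> s" "s \<le> h" "0 \<le> t" "t \<le> h" for s t k l
    using d0(2) that by (force simp: d_def dist_commute)
  obtain s t where st: "0 < s" "s < h" "0 < t" "t < h"
    "\<phi> (x + h *\<^sub>R axis i 1 + h *\<^sub>R axis j 1) - \<phi> (x + h *\<^sub>R axis i 1) - \<phi> (x + h *\<^sub>R axis j 1) + \<phi> x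
       = h * h * ?p (x + s *\<^sub>R axis i 1 + t *\<^sub>R axis j 1)"
    using second_difference[OF \<open>h > 0\<close> inU d1 d2] by blast
  obtain s' t' where st': "0 < s'" "s' < h" "0 < t'" "t' < h"
    "\<phi> (x + h *\<^sub>R axis j 1 + h *\<^sub>R axis i 1) - \<phi> (x + h *\<^sub>R axis j 1) - \<phi> (x + h *\<^sub>R axis i 1) + \<phi> x
       = h * h * ?q (x + s' *\<^sub>R axis j 1 + t' *\<^sub>R axis i 1)"
    using second_difference[OF \<open>h > 0\<close> inU d1 d2] by blast
  have "h * h * ?p (x + s *\<^sub>R axis i 1 + t *\<^sub>R axis j 1)
      = h * h * ?q (x + s' *\<^sub>R axis j 1 + t' *\<^sub>R axis i 1)"
    using st(5) st'(5) by (simp add: algebra_simps)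
  then have eq: "?p (x + s *\<^sub>R axis i 1 + t *\<^sub>R axis j 1) = ?q (x + s' *\<^sub>R axis j 1 + t' *\<^sub>R axis i 1)"
    using \<open>h > 0\<close> by simp
  have "dist (?p (x + s *\<^sub>R axis i 1 + t *\<^sub>R axis j 1)) (?p x) < e"
    using st close[of s t i j] by (intro dp) (simp add: d_def)
  moreover have "dist (?q (x + s' *\<^sub>R axis j 1 + t' *\<^sub>R axis i 1)) (?q x) < e"
    using st' close[of s' t' j i] by (intro dq) (simp add: d_def)
  ultimately show False
    unfolding eq by (simp add: e_def dist_real_def abs_if split: if_splits)
qed

section \<open>Smooth functions\<close>

text \<open>The sum and product rules for \<open>pd\<close> are available at points of
  \<open>U\<close> only, not as equations between functions; this transfers the smoothness of their
  right-hand sides.\<close>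

lemma Ck_on_cong:
  assumes "open U"
  shows "(\<And>x. x \<in> U \<Longrightarrow> f x = g x) \<Longrightarrow> Ck_on m U f \<Longrightarrow> Ck_on m U g"
proof (induction m arbitrary: f g)
  case 0
  then show ?case using continuous_on_cong[of U U f g] by simp
next
  case (Suc m)
  have "Ck_on m U (pd k g)" for k
    using Suc.IH[of "pd k f" "pd k g"] pd_cong_open[OF assms _ Suc.prems(1)] Suc.prems(2) by simp
  moreover have "g differentiable (at x)" if "x \<in> U" for x
    using differentiable_cong_open[OF assms that Suc.prems(1)] Suc.prems(2) that by simp
  ultimately show ?case by simp
qed

lemma Ck_on_SucD: "Ck_on (Suc m) U f \<Longrightarrow> Ck_on m U f"
proof (induction m arbitrary: f)
  case 0
  then show ?case
    by (auto intro!: continuous_at_imp_continuous_on differentiable_imp_continuous_within)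
qed auto

lemma Ck_on_const: "Ck_on m U (\<lambda>_. c)"
proof (induction m arbitrary: c)
  case (Suc m)
  have "pd k (\<lambda>_. c) = (\<lambda>_. 0)" for k :: 'a by (simp add: fun_eq_iff)
  with Suc show ?case by simp
qed simp

lemma Ck_on_add:
  assumes "open U"
  shows "Ck_on m U f \<Longrightarrow> Ck_on m U g \<Longrightarrow> Ck_on m U (\<lambda>x. f x + g x)"
proof (induction m arbitrary: f g)
  case (Suc m)
  have "Ck_on m U (pd k (\<lambda>x. f x + g x))" for k
  proof (rule Ck_on_cong[OF assms])
    show "Ck_on m U (\<lambda>x. pd k f x + pd k g x)" using Suc by simp
  qed (use Suc.prems in \<open>simp add: pd_add\<close>)
  with Suc.prems show ?case by simp
qed (simp add: continuous_on_add)

lemma Ck_on_mult: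
  assumes "open U"
  shows "Ck_on m U f \<Longrightarrow> Ck_on m U g \<Longrightarrow> Ck_on m U (\<lambda>x. f x * g x)"
proof (induction m arbitrary: f g)
  case (Suc m)
  have "Ck_on m U (pd k (\<lambda>x. f x * g x))" for k
  proof (rule Ck_on_cong[OF assms])
    show "Ck_on m U (\<lambda>x. pd k f x * g x + f x * pd k g x)"
      using Suc.prems Ck_on_SucD[OF Suc.prems(1)] Ck_on_SucD[OF Suc.prems(2)]
      by (intro Ck_on_add[OF assms] Suc.IH) auto
  qed (use Suc.prems in \<open>simp add: pd_mult\<close>)
  with Suc.prems show ?case by simp
qed (simp add: continuous_on_mult)

lemma smooth_on_const: "smooth_on U (\<lambda>_. c)"
  by (simp add: smooth_on_def Ck_on_const)

lemma smooth_on_add: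
  "open U \<Longrightarrow> smooth_on U f \<Longrightarrow> smooth_on U g \<Longrightarrow> smooth_on U (\<lambda>x. f x + g x)"
  by (simp add: smooth_on_def Ck_on_add)

lemma smooth_on_mult:
  "open U \<Longrightarrow> smooth_on U f \<Longrightarrow> smooth_on U g \<Longrightarrow> smooth_on U (\<lambda>x. f x * g x)"
  by (simp add: smooth_on_def Ck_on_mult)

lemma smooth_on_diff:
  assumes "open U" "smooth_on U f" "smooth_on U g"
  shows "smooth_on U (\<lambda>x. f x - g x)"
  using smooth_on_add[OF assms(1,2) smooth_on_mult[OF assms(1) smooth_on_const assms(3), of "-1"]]
  by simp

lemma smooth_on_vec_nth: "smooth_on U (\<lambda>x. x $ i)"
  unfolding smooth_on_def
proof
  fix m
  have "pd k (\<lambda>x. x $ i) = (\<lambda>_. if i = k then 1 else 0)" for k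
    by (simp add: fun_eq_iff pd_vec_nth)
  then show "Ck_on m U (\<lambda>x. x $ i)"
    by (cases m) (simp_all add: Ck_on_const continuous_on_component)
qed

lemma smooth_on_imp_differentiable: "smooth_on U f \<Longrightarrow> x \<in> U \<Longrightarrow> f differentiable (at x)"
  unfolding smooth_on_def by (metis Ck_on.simps(2))

lemma smooth_on_pd: "smooth_on U f \<Longrightarrow> smooth_on U (pd k f)"
  unfolding smooth_on_def by (metis Ck_on.simps(2))

lemma smooth_on_imp_continuous_on: "smooth_on U f \<Longrightarrow> continuous_on U f"
  unfolding smooth_on_def by (metis Ck_on.simps(1))

lemma smooth_on_pd_commute:
  fixes f :: "real^'n::finite \<Rightarrow> real"
  assumes "open U" "smooth_on U f" "x \<in> U"
  shows "pd i (pd j f) x = pd j (pd i f) x"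
  using assms
  by (intro pd_commute[of U]) (auto intro: smooth_on_imp_differentiable smooth_on_imp_continuous_on smooth_on_pd)

section \<open>Flat contravariant metrics in two dimensions\<close>

text \<open>Cramer's rule. \<open>matrix_inv\<close> is a \<open>SOME\<close> choice, identified
  with the scaled adjugate \<open>?K\<close> because a left inverse equals a right inverse.\<close>

lemma matrix_inv_2:
  fixes M :: "real^2^2"
  assumes "det M \<noteq> 0"
  shows "matrix_inv M $ 1 $ 1 = M $ 2 $ 2 / det M" "matrix_inv M $ 1 $ 2 = - M $ 1 $ 2 / det M"
    "matrix_inv M $ 2 $ 1 = - M $ 2 $ 1 / det M" "matrix_inv M $ 2 $ 2 = M $ 1 $ 1 / det M"
proof -
  let ?adj = "vector [vector [M$2$2, - M$1$2], vector [- M$2$1, M$1$1]] :: real^2^2"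
  let ?K = "(1 / det M) *\<^sub>R ?adj"
  have "M ** ?adj = det M *\<^sub>R mat 1"
    by (simp add: vec_eq_iff forall_2 matrix_matrix_mult_def sum_2 mat_def det_2 algebra_simps)
  moreover have "M ** ?K = (1 / det M) *\<^sub>R (M ** ?adj)"
    by (simp add: vec_eq_iff matrix_matrix_mult_def sum_distrib_left mult.left_commute)
  ultimately have K: "M ** ?K = mat 1"
    using assms by simp
  obtain A where "A ** M = mat 1" "M ** A = mat 1"
    using assms invertible_det_nz[of M] unfolding invertible_def by blast
  then have inv: "matrix_inv M ** M = mat 1"
    unfolding matrix_inv_def by (metis (mono_tags, lifting) someI)
  have "matrix_inv M = matrix_inv M ** (M ** ?K)" by (simp only: K matrix_mul_rid)
  also have "\<dots> = ?K" by (simp only: matrix_mul_assoc inv matrix_mul_lid)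
  finally have "matrix_inv M = ?K" .
  then show "matrix_inv M $ 1 $ 1 = M $ 2 $ 2 / det M" "matrix_inv M $ 1 $ 2 = - M $ 1 $ 2 / det M"
    "matrix_inv M $ 2 $ 1 = - M $ 2 $ 1 / det M" "matrix_inv M $ 2 $ 2 = M $ 1 $ 1 / det M"
    by simp_all
qed

section \<open>Symmetric contravariant metrics and their inverses\<close>

locale metric_2 =
  fixes W :: "(real^2) set" and h :: "real^2 \<Rightarrow> real^2^2"
  assumes open_W: "open W"
    and det_nz: "x \<in> W \<Longrightarrow> det (h x) \<noteq> 0"
    and sym: "x \<in> W \<Longrightarrow> transpose (h x) = h x"
    and diff_h: "x \<in> W \<Longrightarrow> (\<lambda>y. h y $ i $ j) differentiable (at x)"
begin

lemma h21: "x \<in> W \<Longrightarrow> h x $ 2 $ 1 = h x $ 1 $ 2"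
  using sym[of x] by (simp add: transpose_def vec_eq_iff)

lemma det_h: "x \<in> W \<Longrightarrow> det (h x) = h x $ 1 $ 1 * h x $ 2 $ 2 - h x $ 1 $ 2 * h x $ 1 $ 2"
  by (simp add: det_2 h21)

lemma cov_h:
  assumes "x \<in> W"
  shows "cov h 1 1 x = h x $ 2 $ 2 / det (h x)" "cov h 1 2 x = - h x $ 1 $ 2 / det (h x)"
    "cov h 2 1 x = - h x $ 1 $ 2 / det (h x)" "cov h 2 2 x = h x $ 1 $ 1 / det (h x)"
  using matrix_inv_2[OF det_nz[OF assms]] h21[OF assms] by (simp_all add: cov_def)

text \<open>The entries of \<open>cov h\<close> times \<open>h\<close>, kept polynomial so that
  \<open>algebra\<close> can eliminate the inverse metric without division.\<close>

lemma cov_h_mult: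
  assumes "x \<in> W"
  shows "cov h 1 1 x * h x $ 1 $ 1 + cov h 1 2 x * h x $ 1 $ 2 = 1"
    "cov h 1 1 x * h x $ 1 $ 2 + cov h 1 2 x * h x $ 2 $ 2 = 0"
    "cov h 1 2 x * h x $ 1 $ 1 + cov h 2 2 x * h x $ 1 $ 2 = 0"
    "cov h 1 2 x * h x $ 1 $ 2 + cov h 2 2 x * h x $ 2 $ 2 = 1"
  using det_nz[OF assms] by (simp_all add: cov_h[OF assms] det_h[OF assms] divide_simps)

lemma differentiable_cov:
  assumes "x \<in> W"
  shows "cov h i j differentiable (at x)"
proof -
  have det: "(\<lambda>y. det (h y)) differentiable (at x)"
    unfolding det_2 by (intro differentiable_diff differentiable_mult diff_h assms)
  have "cov h 1 1 differentiable (at x)" "cov h 1 2 differentiable (at x)"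
    "cov h 2 1 differentiable (at x)" "cov h 2 2 differentiable (at x)"
    by (rule cov_h[symmetric, THEN differentiable_cong_open[OF open_W assms]], assumption,
        intro differentiable_divide differentiable_minus diff_h det det_nz assms)+
  then show ?thesis using exhaust_2[of i] exhaust_2[of j] by auto
qed

lemma pd_cov_sym: "x \<in> W \<Longrightarrow> pd k (cov h 2 1) x = pd k (cov h 1 2) x"
  by (rule pd_cong_open[OF open_W]) (simp_all add: cov_h)

lemma pd_h21: "x \<in> W \<Longrightarrow> pd k (\<lambda>y. h y $ 2 $ 1) x = pd k (\<lambda>y. h y $ 1 $ 2) x"
  by (rule pd_cong_open[OF open_W]) (simp_all add: h21)

text \<open>The derivative of an inverse matrix, \<open>dh = - h (d cov) h\<close>, obtained by
  differentiating the relations \<open>cov_h_mult\<close>.\<close>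

lemma pd_h:
  assumes x: "x \<in> W"
  shows "pd k (\<lambda>y. h y $ i $ j) x = - (\<Sum>s\<in>UNIV. \<Sum>l\<in>UNIV. h x $ i $ s * pd k (cov h s l) x * h x $ l $ j)"
proof -
  have prod0: "pd k (cov h i1 j1) x * h x $ i2 $ j2 + cov h i1 j1 x * pd k (\<lambda>y. h y $ i2 $ j2) x
      + (pd k (cov h i3 j3) x * h x $ i4 $ j4 + cov h i3 j3 x * pd k (\<lambda>y. h y $ i4 $ j4) x) = 0"
    if c: "\<And>y. y \<in> W \<Longrightarrow> cov h i1 j1 y * h y $ i2 $ j2 + cov h i3 j3 y * h y $ i4 $ j4 = c"
    for i1 j1 i2 j2 i3 j3 i4 j4 c
  proof -
    have "pd k (\<lambda>y. cov h i1 j1 y * h y $ i2 $ j2 + cov h i3 j3 y * h y $ i4 $ j4) x = pd k (\<lambda>_. c) x"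
      by (rule pd_cong_open[OF open_W x c])
    then show ?thesis
      by (simp add: pd_add pd_mult differentiable_cov diff_h x)
  qed
  note p = cov_h_mult[THEN prod0] and q = cov_h_mult[OF x]
  have "pd k (\<lambda>y. h y $ 1 $ 1) x = - (\<Sum>s\<in>UNIV. \<Sum>l\<in>UNIV. h x $ 1 $ s * pd k (cov h s l) x * h x $ l $ 1)"
    unfolding sum_2 using p q unfolding h21[OF x] pd_cov_sym[OF x] pd_h21[OF x] by algebra
  moreover have "pd k (\<lambda>y. h y $ 1 $ 2) x = - (\<Sum>s\<in>UNIV. \<Sum>l\<in>UNIV. h x $ 1 $ s * pd k (cov h s l) x * h x $ l $ 2)"
    unfolding sum_2 using p q unfolding h21[OF x] pd_cov_sym[OF x] pd_h21[OF x] by algebra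
  moreover have "pd k (\<lambda>y. h y $ 2 $ 1) x = - (\<Sum>s\<in>UNIV. \<Sum>l\<in>UNIV. h x $ 2 $ s * pd k (cov h s l) x * h x $ l $ 1)"
    unfolding sum_2 using p q unfolding h21[OF x] pd_cov_sym[OF x] pd_h21[OF x] by algebra
  moreover have "pd k (\<lambda>y. h y $ 2 $ 2) x = - (\<Sum>s\<in>UNIV. \<Sum>l\<in>UNIV. h x $ 2 $ s * pd k (cov h s l) x * h x $ l $ 2)"
    unfolding sum_2 using p q unfolding h21[OF x] pd_cov_sym[OF x] pd_h21[OF x] by algebra
  ultimately show ?thesis using exhaust_2[of i] exhaust_2[of j] by auto
qed

lemma christoffel_sym:
  assumes "x \<in> W"
  shows "christoffel h j s k x = christoffel h j k s x"
proof -
  have "pd l (cov h s k) x = pd l (cov h k s) x" for l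
    using pd_cov_sym[OF assms] exhaust_2[of s] exhaust_2[of k] by auto
  then show ?thesis by (simp add: christoffel_def algebra_simps)
qed

end

section \<open>Contravariant Christoffel symbols: compatibility, torsion, curvature\<close>

locale metric_connection_2 = metric_2 +
  fixes C :: "2 \<Rightarrow> 2 \<Rightarrow> 2 \<Rightarrow> real^2 \<Rightarrow> real"
  assumes C_eq: "x \<in> W \<Longrightarrow> C i j k x = - (\<Sum>s\<in>UNIV. h x $ i $ s * christoffel h j s k x)"
begin

text \<open>In \<open>C i j k + C j i k\<close> the part of the Christoffel symbol that is
  antisymmetric in \<open>s\<close> and \<open>l\<close> cancels; by \<open>pd_h\<close> the
  remaining term is the derivative of \<open>h\<close>.\<close>

lemma C_compatible:
  assumes x: "x \<in> W"
  shows "C i j k x + C j i k x = pd k (\<lambda>y. h y $ i $ j) x"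
proof -
  have "C 1 1 k x + C 1 1 k x = pd k (\<lambda>y. h y $ 1 $ 1) x"
    unfolding C_eq[OF x] pd_h[OF x] christoffel_def sum_2
    using exhaust_2[of k] by (auto simp: h21[OF x] pd_cov_sym[OF x] algebra_simps)
  moreover have "C 1 2 k x + C 2 1 k x = pd k (\<lambda>y. h y $ 1 $ 2) x"
    unfolding C_eq[OF x] pd_h[OF x] christoffel_def sum_2
    using exhaust_2[of k] by (auto simp: h21[OF x] pd_cov_sym[OF x] algebra_simps)
  moreover have "C 2 2 k x + C 2 2 k x = pd k (\<lambda>y. h y $ 2 $ 2) x"
    unfolding C_eq[OF x] pd_h[OF x] christoffel_def sum_2
    using exhaust_2[of k] by (auto simp: h21[OF x] pd_cov_sym[OF x] algebra_simps)
  ultimately show ?thesis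
    using exhaust_2[of i] exhaust_2[of j] by (auto simp: pd_h21[OF x] add.commute)
qed

text \<open>Both sides contract \<open>- christoffel h k\<close> with the two rows of
  \<open>h\<close>, in opposite orders of the lower indices.\<close>

lemma C_torsion_free:
  assumes x: "x \<in> W"
  shows "(\<Sum>s\<in>UNIV. h x $ 1 $ s * C 2 k s x) = (\<Sum>s\<in>UNIV. h x $ 2 $ s * C 1 k s x)"
  unfolding C_eq[OF x] sum_2 by (simp add: h21[OF x] christoffel_sym[OF x, of k 2 1] algebra_simps)

text \<open>\<open>C_eq\<close> solved for the Christoffel symbols, which makes them differentiable
  when \<open>C\<close> is.\<close>

lemma christoffel_eq:
  assumes x: "x \<in> W"
  shows "christoffel h j s k x = - (\<Sum>i\<in>UNIV. cov h s i x * C i j k x)"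
proof -
  note q = cov_h_mult[OF x]
  have c21: "cov h 2 1 x = cov h 1 2 x" by (simp add: cov_h[OF x])
  have "christoffel h j 1 k x = - (\<Sum>i\<in>UNIV. cov h 1 i x * C i j k x)"
    unfolding C_eq[OF x] sum_2 h21[OF x] using q by algebra
  moreover have "christoffel h j 2 k x = - (\<Sum>i\<in>UNIV. cov h 2 i x * C i j k x)"
    unfolding C_eq[OF x] sum_2 h21[OF x] c21 using q by algebra
  ultimately show ?thesis using exhaust_2[of s] by auto
qed

text \<open>The left side is \<open>det (h x)\<close> times the contraction of
  \<open>riemann h 2 s 1 2\<close> with \<open>h x $ 1 $ s\<close>. Derivatives of \<open>h\<close>
  are replaced through \<open>C_compatible\<close>, and the determinant clears the inverse metric.
  For fixed \<open>C\<close> the result is polynomial in \<open>h\<close>, so coefficients can be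
  compared along the pencil.\<close>

lemma C_curvature:
  assumes x: "x \<in> W" and flat: "flat_on W h"
    and diff_C: "\<And>i j k y. y \<in> W \<Longrightarrow> C i j k differentiable (at y)"
  shows "det (h x) * (pd 2 (C 1 2 1) x - pd 1 (C 1 2 2) x)
     + h x $ 2 $ 2 * (C 1 1 1 x * C 1 2 2 x - C 1 1 2 x * C 1 2 1 x)
     - h x $ 1 $ 2 * (C 1 1 1 x * C 2 2 2 x - C 1 1 2 x * C 2 2 1 x
                      + C 2 1 1 x * C 1 2 2 x - C 2 1 2 x * C 1 2 1 x)
     + h x $ 1 $ 1 * (C 2 1 1 x * C 2 2 2 x - C 2 1 2 x * C 2 2 1 x) = 0"
proof -
  have diff_\<Gamma>: "christoffel h j s k differentiable (at x)" for j s k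
    by (rule differentiable_cong_open[OF open_W x christoffel_eq[symmetric]])
       (auto simp: sum_2 intro!: derivative_intros differentiable_cov diff_C x)
  have pd_C: "pd l (C i j k) x = - (\<Sum>s\<in>UNIV. pd l (\<lambda>y. h y $ i $ s) x * christoffel h j s k x
      + h x $ i $ s * pd l (christoffel h j s k) x)" for i j k l
  proof -
    have "pd l (C i j k) x = pd l (\<lambda>y. - (\<Sum>s\<in>UNIV. h y $ i $ s * christoffel h j s k y)) x"
      by (rule pd_cong_open[OF open_W x C_eq])
    also have "\<dots> = - (\<Sum>s\<in>UNIV. pd l (\<lambda>y. h y $ i $ s) x * christoffel h j s k x
      + h x $ i $ s * pd l (christoffel h j s k) x)"
      unfolding sum_2
      by (subst pd_minus pd_add, (intro derivative_intros diff_\<Gamma> diff_h x)+)+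
         (simp add: pd_mult diff_\<Gamma> diff_h x)
    finally show ?thesis .
  qed
  have sym12: "christoffel h j 2 1 y = christoffel h j 1 2 y" if "y \<in> W" for j y
    using christoffel_sym[OF that] .
  have R: "riemann h 2 1 1 2 x = 0" "riemann h 2 2 1 2 x = 0"
    using flat x by (auto simp: flat_on_def)
  have pd12: "pd k (christoffel h j 2 1) x = pd k (christoffel h j 1 2) x" for j k
    by (rule pd_cong_open[OF open_W x sym12])
  have E: "pd 2 (C 1 2 1) x - pd 1 (C 1 2 2) x
    = - (\<Sum>s\<in>UNIV. (C 1 s 2 x + C s 1 2 x) * christoffel h 2 s 1 x + h x $ 1 $ s * pd 2 (christoffel h 2 s 1) x)
      + (\<Sum>s\<in>UNIV. (C 1 s 1 x + C s 1 1 x) * christoffel h 2 s 2 x + h x $ 1 $ s * pd 1 (christoffel h 2 s 2) x)"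
    unfolding pd_C C_compatible[OF x] by simp
  show ?thesis
    using R unfolding E riemann_def C_eq[OF x] sum_2 det_h[OF x] h21[OF x] sym12[OF x] pd12
    by algebra
qed

end

section \<open>The equations of the pencil\<close>

text \<open>In the application \<open>\<tau>\<close> is the off-diagonal entry and \<open>m\<close>
  the product of the diagonal entries, so the excluded \<open>\<tau>\<close> are those where the
  metric degenerates. Three admissible values determine a quadratic.\<close>

lemma quadratic_vanishing:
  fixes m p q r :: real
  assumes "\<And>\<tau>. \<tau>\<^sup>2 \<noteq> m \<Longrightarrow> p * \<tau>\<^sup>2 + q * \<tau> + r = 0"
  shows "p = 0" "q = 0" "r = 0"
proof -
  \<comment> \<open>With this choice the squares of \<open>N\<close>, \<open>- N\<close> and
    \<open>N + 1\<close> all exceed \<open>m\<close>.\<close>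
  define N where "N = \<bar>m\<bar> + 1"
  have N: "N \<ge> 1" "m < N" by (auto simp: N_def)
  have "N \<le> N\<^sup>2" "N \<le> (N + 1)\<^sup>2"
    using N by (auto simp: power2_eq_square algebra_simps)
  then have ne: "N\<^sup>2 \<noteq> m" "(- N)\<^sup>2 \<noteq> m" "(N + 1)\<^sup>2 \<noteq> m" using N by auto
  have e: "p * N\<^sup>2 + q * N + r = 0" "p * N\<^sup>2 - q * N + r = 0"
    "p * (N + 1)\<^sup>2 + q * (N + 1) + r = 0"
    using assms[OF ne(1)] assms[OF ne(2)] assms[OF ne(3)] by simp_all
  from e(1,2) have "q * N = 0" by linarith
  with N show q: "q = 0" by simp
  have "p * (2 * N + 1) = 0" using e(1,3) q by (simp add: power2_eq_square algebra_simps)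
  with N show p: "p = 0" by simp
  show "r = 0" using e(1) p q by simp
qed

lemma A_op_simps [simp]:
  "lead A_op x $ 1 $ 1 = 0" "lead A_op x $ 1 $ 2 = 1"
  "lead A_op x $ 2 $ 1 = 1" "lead A_op x $ 2 $ 2 = 0" "conn A_op i j k x = 0"
  by (simp_all add: A_op_def)

lemma pencil_simps [simp]:
  "lead (pencil A B t) x = lead B x + t *\<^sub>R lead A x"
  "conn (pencil A B t) i j k x = conn B i j k x + t * conn A i j k x"
  "kap (pencil A B t) = kap B" "tail (pencil A B t) = tail B"
  by (simp_all add: pencil_def)

text \<open>\<open>killing\<close> is Killing's equation in contravariant components.
  \<open>torsion\<close> comes from the constant coefficients in \<open>\<tau>\<close> of the
  torsion identities, \<open>curvature1\<close> and \<open>curvature2\<close> from the coefficients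
  of \<open>\<tau>^2\<close> and \<open>\<tau>\<close> in the curvature identity, once the symbols
  are expressed through \<open>a\<close>, \<open>b\<close>, \<open>c\<close>.\<close>

locale pencil_eqs =
  fixes U :: "(real^2) set" and a b c :: "real^2 \<Rightarrow> real"
  assumes open_U: "open U" and connected_U: "connected U"
    and smooth_abc: "smooth_on U a" "smooth_on U b" "smooth_on U c"
    and nondeg: "x \<in> U \<Longrightarrow> a x * c x \<noteq> (b x)\<^sup>2"
    and killing:
      "x \<in> U \<Longrightarrow> x$1 * pd 1 a x - x$2 * pd 2 a x = 2 * a x"
      "x \<in> U \<Longrightarrow> x$1 * pd 1 b x - x$2 * pd 2 b x = 0"
      "x \<in> U \<Longrightarrow> x$1 * pd 1 c x - x$2 * pd 2 c x = - 2 * c x"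
    and torsion:
      "x \<in> U \<Longrightarrow> a x * (2 * pd 1 b x - pd 2 c x) = c x * pd 2 a x"
      "x \<in> U \<Longrightarrow> c x * (2 * pd 2 b x - pd 1 a x) = a x * pd 1 c x"
    and curvature1: "x \<in> U \<Longrightarrow> pd 1 (pd 1 a) x + pd 2 (pd 2 c) x = 2 * pd 1 (pd 2 b) x"
    and curvature2: "x \<in> U \<Longrightarrow> pd 2 a x * pd 1 c x = (2 * pd 2 b x - pd 1 a x) * (2 * pd 1 b x - pd 2 c x)"

lemma bihamiltonian_imp_pencil_eqs:
  fixes U :: "(real^2) set" and B :: "2 nonlocal_op"
  assumes U: "open U" "connected U"
    and smooth_g: "\<forall>i j. smooth_on U (\<lambda>x. lead B x $ i $ j)"
    and smooth_C: "\<forall>i j k. smooth_on U (conn B i j k)"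
    and det_g: "\<forall>x\<in>U. det (lead B x) \<noteq> 0"
    and tail: "kap B \<noteq> 0" "tail B = hyp_rot"
    and bi: "bihamiltonian_on U A_op B"
  shows "pencil_eqs U (\<lambda>x. lead B x $ 1 $ 1) (\<lambda>x. lead B x $ 1 $ 2) (\<lambda>x. lead B x $ 2 $ 2)"
    and "x \<in> U \<Longrightarrow> lead B x $ 2 $ 1 = lead B x $ 1 $ 2"
proof -
  define h where "h t = lead (pencil A_op B t)" for t
  define W where "W t = {x \<in> U. det (h t x) \<noteq> 0}" for t
  let ?a = "\<lambda>x. lead B x $ 1 $ 1" and ?b = "\<lambda>x. lead B x $ 1 $ 2" and ?c = "\<lambda>x. lead B x $ 2 $ 2"
  have h_eq: "h t x $ i $ j = lead B x $ i $ j + t * lead A_op x $ i $ j" for t x i j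
    by (simp add: h_def)
  have diff_g: "(\<lambda>y. lead B y $ i $ j) differentiable (at x)" if "x \<in> U" for x i j
    using smooth_g smooth_on_imp_differentiable that by blast
  have diff_C: "conn B i j k differentiable (at x)" if "x \<in> U" for x i j k
    using smooth_C smooth_on_imp_differentiable that by blast
  have diff_h: "(\<lambda>y. h t y $ i $ j) differentiable (at x)" if "x \<in> U" for x i j t
  proof -
    have "(\<lambda>y. lead A_op y $ i $ j) = (\<lambda>_. lead A_op x $ i $ j)" by (simp add: A_op_def)
    then have "(\<lambda>y. lead A_op y $ i $ j) differentiable (at x)" by simp
    with diff_g[OF that] show ?thesis
      unfolding h_eq by (intro derivative_intros)
  qed
  have ham: "local_hamiltonian_on (W t) (pencil A_op B t)" "killing_on (W t) (h t) hyp_rot" for t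
    using bi tail by (simp_all add: bihamiltonian_on_def hamiltonian_on_def W_def h_def)
  have flat: "flat_on (W t) (h t)" for t
    using ham(1) by (simp add: local_hamiltonian_on_def h_def)
  \<comment> \<open>The symbols of \<open>A_op\<close> vanish, so the single family
    \<open>conn B\<close> serves every member of the pencil.\<close>
  have conn: "metric_connection_2 (W t) (h t) (conn B)" for t
  proof
    have "continuous_on U (\<lambda>x. det (h t x))"
      unfolding det_2
      by (intro continuous_intros continuous_at_imp_continuous_on ballI
          differentiable_imp_continuous_within diff_h)
    then show "open (W t)"
      using continuous_open_preimage[OF _ U(1), of "\<lambda>x. det (h t x)" "- {0}"]
      by (simp add: W_def vimage_def Int_def open_Compl)
    show "det (h t x) \<noteq> 0" "transpose (h t x) = h t x"
      "(\<lambda>y. h t y $ i $ j) differentiable (at x)" if "x \<in> W t" for x i j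
      using ham(1)[of t] that diff_h by (auto simp: W_def local_hamiltonian_on_def h_def)
    show "conn B i j k x = - (\<Sum>s\<in>UNIV. h t x $ i $ s * christoffel (h t) j s k x)"
      if "x \<in> W t" for i j k x
      using ham(1)[of t] that by (simp add: local_hamiltonian_on_def h_def)
  qed
  have h0: "h 0 = lead B" by (simp add: h_def fun_eq_iff)
  have W0: "W 0 = U" using det_g by (auto simp: W_def h0)
  interpret g: metric_connection_2 U "lead B" "conn B"
    using conn[of 0] by (simp add: h0 W0)
  show g21: "lead B x $ 2 $ 1 = lead B x $ 1 $ 2" if "x \<in> U" for x
    using g.h21[OF that] .
  have C11: "conn B 1 1 k x = pd k ?a x / 2" and C22: "conn B 2 2 k x = pd k ?c x / 2"
    and C12: "conn B 1 2 k x + conn B 2 1 k x = pd k ?b x" if "x \<in> U" for k x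
    using g.C_compatible[OF that, of 1 1 k] g.C_compatible[OF that, of 2 2 k]
      g.C_compatible[OF that, of 1 2 k] by simp_all
  \<comment> \<open>At a fixed \<open>x\<close> the parameter \<open>t = \<tau> - b x\<close> makes
    the off-diagonal entry \<open>\<tau>\<close> and the determinant
    \<open>a c - \<tau>^2\<close>.\<close>
  have in_W: "x \<in> W (\<tau> - ?b x)" if "x \<in> U" "\<tau>\<^sup>2 \<noteq> ?a x * ?c x" for x \<tau>
    using that by (simp add: W_def det_2 h_eq g21 power2_eq_square)
  have tors: "conn B 2 k 2 x = conn B 1 k 1 x"
    "?a x * conn B 2 k 1 x = ?c x * conn B 1 k 2 x" if x: "x \<in> U" for k x
  proof -
    have "0 * \<tau>\<^sup>2 + (conn B 2 k 2 x - conn B 1 k 1 x) * \<tau>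
        + (?a x * conn B 2 k 1 x - ?c x * conn B 1 k 2 x) = 0" if "\<tau>\<^sup>2 \<noteq> ?a x * ?c x" for \<tau>
    proof -
      interpret t: metric_connection_2 "W (\<tau> - ?b x)" "h (\<tau> - ?b x)" "conn B" by (rule conn)
      show ?thesis
        using t.C_torsion_free[OF in_W[OF x that], of k]
        by (simp add: sum_2 h_eq g21[OF x] algebra_simps)
    qed
    from quadratic_vanishing(2,3)[OF this] show "conn B 2 k 2 x = conn B 1 k 1 x"
      "?a x * conn B 2 k 1 x = ?c x * conn B 1 k 2 x" by simp_all
  qed
  \<comment> \<open>Compatibility and the part of the torsion identities linear in
    \<open>\<tau>\<close> determine the mixed symbols.\<close>
  have C_eqs: "conn B 1 2 1 x = pd 2 ?c x / 2" "conn B 2 1 2 x = pd 1 ?a x / 2"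
    "conn B 1 2 2 x = pd 2 ?b x - pd 1 ?a x / 2" "conn B 2 1 1 x = pd 1 ?b x - pd 2 ?c x / 2"
    if "x \<in> U" for x
    using tors(1)[OF that, of 1] tors(1)[OF that, of 2] C11[OF that] C22[OF that]
      C12[OF that, of 1] C12[OF that, of 2] by simp_all
  have curv: "pd 2 (conn B 1 2 1) x = pd 1 (conn B 1 2 2) x"
    "conn B 1 1 1 x * conn B 2 2 2 x - conn B 1 1 2 x * conn B 2 2 1 x
       + conn B 2 1 1 x * conn B 1 2 2 x - conn B 2 1 2 x * conn B 1 2 1 x = 0"
    if x: "x \<in> U" for x
  proof -
    let ?E = "pd 2 (conn B 1 2 1) x - pd 1 (conn B 1 2 2) x"
    let ?Q = "conn B 1 1 1 x * conn B 2 2 2 x - conn B 1 1 2 x * conn B 2 2 1 x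
       + conn B 2 1 1 x * conn B 1 2 2 x - conn B 2 1 2 x * conn B 1 2 1 x"
    let ?r = "?a x * ?c x * ?E + ?c x * (conn B 1 1 1 x * conn B 1 2 2 x - conn B 1 1 2 x * conn B 1 2 1 x)
       + ?a x * (conn B 2 1 1 x * conn B 2 2 2 x - conn B 2 1 2 x * conn B 2 2 1 x)"
    have "(- ?E) * \<tau>\<^sup>2 + (- ?Q) * \<tau> + ?r = 0" if "\<tau>\<^sup>2 \<noteq> ?a x * ?c x" for \<tau>
    proof -
      interpret t: metric_connection_2 "W (\<tau> - ?b x)" "h (\<tau> - ?b x)" "conn B" by (rule conn)
      have "h (\<tau> - ?b x) x $ 1 $ 1 = ?a x" "h (\<tau> - ?b x) x $ 1 $ 2 = \<tau>" "h (\<tau> - ?b x) x $ 2 $ 2 = ?c x"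
        by (simp_all add: h_eq)
      note this[simp]
      have "(?a x * ?c x - \<tau> * \<tau>) * ?E
          + ?c x * (conn B 1 1 1 x * conn B 1 2 2 x - conn B 1 1 2 x * conn B 1 2 1 x) - \<tau> * ?Q
          + ?a x * (conn B 2 1 1 x * conn B 2 2 2 x - conn B 2 1 2 x * conn B 2 2 1 x) = 0"
        using t.C_curvature[OF in_W[OF x that] flat diff_C] t.det_h[OF in_W[OF x that]]
        by (simp add: W_def)
      then show ?thesis by (simp add: power2_eq_square algebra_simps)
    qed
    from quadratic_vanishing(1,2)[OF this] show "pd 2 (conn B 1 2 1) x = pd 1 (conn B 1 2 2) x" "?Q = 0"
      by simp_all
  qed
  show "pencil_eqs U ?a ?b ?c"
  proof
    show "open U" "connected U" "smooth_on U ?a" "smooth_on U ?b" "smooth_on U ?c"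
      using U smooth_g by blast+
    fix x assume x: "x \<in> U"
    show "?a x * ?c x \<noteq> (?b x)\<^sup>2"
      using g.det_nz[OF x] g.det_h[OF x] by (simp add: power2_eq_square)
    show "?a x * (2 * pd 1 ?b x - pd 2 ?c x) = ?c x * pd 2 ?a x"
      "?c x * (2 * pd 2 ?b x - pd 1 ?a x) = ?a x * pd 1 ?c x"
      using tors(2)[OF x, of 1] tors(2)[OF x, of 2] unfolding C_eqs[OF x] C11[OF x] C22[OF x]
      by (simp_all add: algebra_simps)
    have "pd 2 (\<lambda>y. (1/2) * pd 2 ?c y) x = pd 1 (\<lambda>y. pd 2 ?b y - (1/2) * pd 1 ?a y) x"
      using curv(1)[OF x] pd_cong_open[OF U(1) x C_eqs(1)] pd_cong_open[OF U(1) x C_eqs(3)] by simp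
    moreover have "pd k (\<lambda>y. lead B y $ i $ j) differentiable (at x)" for k i j
      using smooth_on_imp_differentiable[OF smooth_on_pd x] smooth_g by blast
    ultimately show "pd 1 (pd 1 ?a) x + pd 2 (pd 2 ?c) x = 2 * pd 1 (pd 2 ?b) x"
      by (simp add: pd_diff pd_divide_const)
    show "pd 2 ?a x * pd 1 ?c x = (2 * pd 2 ?b x - pd 1 ?a x) * (2 * pd 1 ?b x - pd 2 ?c x)"
      using curv(2)[OF x] unfolding C_eqs[OF x] C11[OF x] C22[OF x] by (simp add: field_simps)
    have rot: "hyp_rot x $ 1 = x $ 1" "hyp_rot x $ 2 = - x $ 2"
      "pd i (\<lambda>y. hyp_rot y $ 1) x = (if i = 1 then 1 else 0)"
      "pd i (\<lambda>y. hyp_rot y $ 2) x = (if i = 2 then - 1 else 0)" for i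
      by (simp_all add: hyp_rot_def pd_minus pd_vec_nth)
    have kill: "(\<Sum>s\<in>UNIV. hyp_rot x $ s * pd s (cov (lead B) i j) x
                   + cov (lead B) s j x * pd i (\<lambda>y. hyp_rot y $ s) x
                   + cov (lead B) i s x * pd j (\<lambda>y. hyp_rot y $ s) x) = 0" for i j
      using ham(2)[of 0] x unfolding killing_on_def W0 h0 by blast
    note k = kill[of 1 1] kill[of 1 2] kill[of 2 2]
    note k' = k[unfolded sum_2 rot, simplified]
    \<comment> \<open>\<open>killing_on\<close> concerns the covariant components;
      \<open>pd_h\<close> and the inverse relations convert it to the contravariant ones.\<close>
    show "x$1 * pd 1 ?a x - x$2 * pd 2 ?a x = 2 * ?a x"
      "x$1 * pd 1 ?b x - x$2 * pd 2 ?b x = 0"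
      "x$1 * pd 1 ?c x - x$2 * pd 2 ?c x = - 2 * ?c x"
      using k' g.cov_h_mult[OF x] unfolding g.pd_h[OF x] sum_2 g21[OF x] g.pd_cov_sym[OF x]
      by algebra+
  qed
qed

section \<open>Solving the equations\<close>

lemma zero_on_closure:
  fixes f :: "'a::topological_space \<Rightarrow> real"
  assumes "open U" "continuous_on U f" "\<And>x. x \<in> U \<Longrightarrow> x \<in> T \<Longrightarrow> f x = 0" "x \<in> U" "x \<in> closure T"
  shows "f x = 0"
proof -
  have "open (U \<inter> f -` (- {0}))"
    using continuous_open_preimage[OF assms(2,1)] by (simp add: open_Compl)
  then have "(U \<inter> f -` (- {0})) \<inter> closure T = {}"
    using open_Int_closure_eq_empty assms(3) by blast
  with assms(4,5) show ?thesis by blast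
qed

text \<open>Moving from \<open>x\<close> in direction (1, 1) meets each axis for one parameter value
  only, while the parameters staying in \<open>U\<close> and \<open>V\<close> form a nonempty open,
  hence infinite, set.\<close>

lemma off_axes_dense:
  fixes U :: "(real^2) set"
  assumes "open U" "x \<in> U"
  shows "x \<in> closure {y \<in> U. y$1 \<noteq> 0 \<and> y$2 \<noteq> 0}"
  unfolding closure_iff_nhds_not_empty
proof (intro allI impI)
  fix A V :: "(real^2) set"
  assume "V \<subseteq> A" "open V" "x \<in> V"
  define p :: "real \<Rightarrow> real^2" where "p s = x + s *\<^sub>R vector [1, 1]" for s
  have "open (p -` (U \<inter> V))"
    by (rule open_vimage) (auto simp: p_def assms \<open>open V\<close> intro!: continuous_intros)
  moreover have "0 \<in> p -` (U \<inter> V)" using assms \<open>x \<in> V\<close> by (simp add: p_def)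
  ultimately have "infinite (p -` (U \<inter> V))"
    using finite_imp_not_open by blast
  then have "infinite (p -` (U \<inter> V) - {- (x$1), - (x$2)})" by simp
  then obtain s where "p s \<in> U" "p s \<in> V" "s \<noteq> - (x$1)" "s \<noteq> - (x$2)"
    using infinite_imp_nonempty by blast
  moreover from this have "p s $ 1 \<noteq> 0" "p s $ 2 \<noteq> 0" by (auto simp: p_def)
  ultimately show "{y \<in> U. y$1 \<noteq> 0 \<and> y$2 \<noteq> 0} \<inter> A \<noteq> {}"
    using \<open>V \<subseteq> A\<close> by blast
qed

lemma zero_off_axes_imp_zero:
  fixes f :: "real^2 \<Rightarrow> real"
  assumes "open U" "continuous_on U f" "x \<in> U"
    and "\<And>y. y \<in> U \<Longrightarrow> y$1 \<noteq> 0 \<Longrightarrow> y$2 \<noteq> 0 \<Longrightarrow> f y = 0"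
  shows "f x = 0"
  using zero_on_closure[OF assms(1,2) _ assms(3) off_axes_dense[OF assms(1,3)]] assms(4) by blast

section \<open>Constancy of \<open>b\<close> and \<open>a c\<close>, and the affine relation between
  \<open>a\<close> and \<open>c\<close>\<close>

context pencil_eqs
begin

lemmas diff0 = smooth_abc[THEN smooth_on_imp_differentiable]
lemmas diff1 = smooth_abc[THEN smooth_on_pd, THEN smooth_on_imp_differentiable]
lemmas cont0 = smooth_abc[THEN smooth_on_imp_continuous_on]
lemmas cont1 = smooth_abc[THEN smooth_on_pd, THEN smooth_on_imp_continuous_on]
lemmas pd_rules = pd_add pd_diff pd_mult pd_vec_nth diff0 diff1

text \<open>The Killing equations for \<open>a\<close> and \<open>c\<close>, differentiated in
  \<open>u\<close> and \<open>v\<close> respectively. They trade mixed second derivatives for pure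
  ones.\<close>

lemma killing_pd:
  assumes x: "x \<in> U"
  shows "x$2 * pd 2 (pd 1 a) x = x$1 * pd 1 (pd 1 a) x - pd 1 a x"
    and "x$1 * pd 1 (pd 2 c) x = x$2 * pd 2 (pd 2 c) x - pd 2 c x"
proof -
  have "pd 1 (\<lambda>y. y$1 * pd 1 a y - y$2 * pd 2 a y) x = pd 1 (\<lambda>y. 2 * a y) x"
    by (rule pd_cong_open[OF open_U x killing(1)])
  then show "x$2 * pd 2 (pd 1 a) x = x$1 * pd 1 (pd 1 a) x - pd 1 a x"
    using x by (simp add: pd_rules smooth_on_pd_commute[OF open_U smooth_abc(1), of _ 2 1])
  have "pd 2 (\<lambda>y. y$1 * pd 1 c y - y$2 * pd 2 c y) x = pd 2 (\<lambda>y. - 2 * c y) x"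
    by (rule pd_cong_open[OF open_U x killing(3)])
  then show "x$1 * pd 1 (pd 2 c) x = x$2 * pd 2 (pd 2 c) x - pd 2 c x"
    using x by (simp add: pd_rules pd_minus derivative_intros
        smooth_on_pd_commute[OF open_U smooth_abc(3), of _ 2 1])
qed

text \<open>Where \<open>b\<close> varies, \<open>v\<^sup>2 a = u\<^sup>2 c\<close>. If this is nonzero, then \<open>u b\<^sub>v = u a\<^sub>u - a\<close>, and
  differentiating in \<open>u\<close> gives \<open>b\<^sub>v = 0\<close>; if it vanishes, then \<open>curvature2\<close> reads \<open>b\<^sub>u b\<^sub>v = 0\<close>.\<close>

lemma pd_b_eq_0_off_axes:
  assumes x: "x \<in> U" "x$1 \<noteq> 0" "x$2 \<noteq> 0"
  shows "pd 1 b x = 0"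
proof (rule ccontr)
  assume nz: "pd 1 b x \<noteq> 0"
  define N where "N = {y \<in> U. y$1 * y$2 * pd 1 b y \<noteq> 0}"
  have open_N: "open N"
    using continuous_open_preimage[OF _ open_U, of "\<lambda>y. y$1 * y$2 * pd 1 b y" "- {0}"]
    by (simp add: N_def vimage_def Int_def open_Compl continuous_intros cont1)
  have x_N: "x \<in> N" using x nz by (simp add: N_def)
  have N: "y \<in> U" "y$1 \<noteq> 0" "y$2 \<noteq> 0" "pd 1 b y \<noteq> 0" if "y \<in> N" for y
    using that by (auto simp: N_def)
  \<comment> \<open>Eliminating the derivatives of \<open>a\<close> and \<open>c\<close> from the
    torsion and Killing equations leaves \<open>v a b_u = u c b_v\<close>, where
    \<open>v b_v = u b_u\<close>.\<close>
  have ac: "y$2 * y$2 * a y = y$1 * y$1 * c y" if "y \<in> N" for y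
  proof -
    have "pd 1 b y * (y$2 * y$2 * a y - y$1 * y$1 * c y) = 0"
      using killing[OF N(1)[OF that]] torsion[OF N(1)[OF that]] by algebra
    with N(4)[OF that] show ?thesis by simp
  qed
  have ac1: "y$2 * y$2 * pd 1 a y = 2 * y$1 * c y + y$1 * y$1 * pd 1 c y" if "y \<in> N" for y
  proof -
    have "pd 1 (\<lambda>y. y$2 * y$2 * a y) y = pd 1 (\<lambda>y. y$1 * y$1 * c y) y"
      by (rule pd_cong_open[OF open_N that ac])
    then show ?thesis using N(1)[OF that] by (simp add: pd_rules derivative_intros)
  qed
  have ac1': "y$2 * pd 1 a y = y$1 * pd 2 c y" if "y \<in> N" for y
  proof -
    have "y$2 * (y$2 * pd 1 a y - y$1 * pd 2 c y) = 0"
      using ac1[OF that] killing(3)[OF N(1)[OF that]] by algebra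
    then show ?thesis using N[OF that] by simp
  qed
  \<comment> \<open>The \<open>u\<close>-derivative of \<open>ac1'\<close> and
    \<open>killing_pd\<close> give \<open>a_uu = c_vv\<close>; then \<open>curvature1\<close> yields
    \<open>a_uu = b_uv\<close>.\<close>
  have ac2: "pd 1 (pd 1 a) y = pd 1 (pd 2 b) y" if "y \<in> N" for y
  proof -
    have "pd 1 (\<lambda>y. y$2 * pd 1 a y) y = pd 1 (\<lambda>y. y$1 * pd 2 c y) y"
      by (rule pd_cong_open[OF open_N that ac1'])
    then have "y$2 * pd 1 (pd 1 a) y = pd 2 c y + y$1 * pd 1 (pd 2 c) y"
      using N(1)[OF that] by (simp add: pd_rules)
    then have "y$2 * (pd 1 (pd 1 a) y - pd 1 (pd 2 b) y) = 0"
      using killing_pd(2)[OF N(1)[OF that]] curvature1[OF N(1)[OF that]] by algebra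
    then show ?thesis using N[OF that] by simp
  qed
  show False
  proof (cases "\<forall>y\<in>N. a y = 0")
    case True
    then have a0: "a y = 0" if "y \<in> N" for y using that by blast
    then have c0: "c y = 0" if "y \<in> N" for y using ac[OF that] that N[OF that] by simp
    have "pd k a x = 0" "pd k c x = 0" for k
      using pd_cong_open[OF open_N x_N, of a "\<lambda>_. 0"] pd_cong_open[OF open_N x_N, of c "\<lambda>_. 0"]
        a0 c0 by simp_all
    then have "pd 2 b x * pd 1 b x = 0" using curvature2[OF x(1)] by simp
    then show False using killing(2)[OF x(1)] x nz by auto
  next
    case False
    then obtain z where z: "z \<in> N" "a z \<noteq> 0" by blast
    define N' where "N' = {y \<in> N. a y \<noteq> 0}"
    have open_N': "open N'"
      using continuous_open_preimage[OF _ open_N, of a "- {0}"] cont0(1) N(1)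
      by (auto simp: N'_def vimage_def Int_def open_Compl intro: continuous_on_subset)
    have "y$1 * pd 2 b y = y$1 * pd 1 a y - a y" if "y \<in> N'" for y
    proof -
      have y: "y \<in> N" "a y \<noteq> 0" using that by (auto simp: N'_def)
      have "y$1 * y$2 * y$2 * a y * (y$1 * pd 2 b y - (y$1 * pd 1 a y - a y)) = 0"
        using ac[OF y(1)] ac1[OF y(1)] torsion(2)[OF N(1)[OF y(1)]] by algebra
      with y N[OF y(1)] show ?thesis by simp
    qed
    from pd_cong_open[where x = z and k = 1, OF open_N' _ this]
    have "pd 1 (\<lambda>y. y$1 * pd 2 b y) z = pd 1 (\<lambda>y. y$1 * pd 1 a y - a y) z"
      using z by (simp add: N'_def)
    \<comment> \<open>By \<open>ac2\<close> the terms \<open>u b_uv\<close> and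
      \<open>u a_uu\<close> cancel.\<close>
    then have "pd 2 b z = 0"
      using N(1)[OF z(1)] ac2[OF z(1)] by (simp add: pd_rules derivative_intros)
    then show False using killing(2)[OF N(1)[OF z(1)]] N[OF z(1)] by simp
  qed
qed

lemma pd_b_eq_0:
  assumes "x \<in> U"
  shows "pd k b x = 0"
proof (rule zero_off_axes_imp_zero[OF open_U cont1(2) assms])
  fix y assume y: "y \<in> U" "y$1 \<noteq> 0" "y$2 \<noteq> 0"
  then have "pd 1 b y = 0" by (rule pd_b_eq_0_off_axes)
  with killing(2)[OF y(1)] y show "pd k b y = 0" using exhaust_2[of k] by auto
qed

lemma b_constant: obtains \<beta> where "\<And>x. x \<in> U \<Longrightarrow> b x = \<beta>"
  using pd_eq_0_imp_constant[OF open_U connected_U diff0(2) pd_b_eq_0] by blast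

text \<open>For constant \<open>b\<close> the torsion equations say that both partial derivatives of
  \<open>a c\<close> vanish.\<close>

lemma ac_constant: obtains \<alpha> where "\<And>x. x \<in> U \<Longrightarrow> a x * c x = \<alpha>"
proof -
  have "pd k (\<lambda>y. a y * c y) x = 0" if x: "x \<in> U" for k x
    using torsion[OF x] exhaust_2[of k] x by (auto simp: pd_rules pd_b_eq_0 algebra_simps)
  then obtain \<alpha> where "\<And>x. x \<in> U \<Longrightarrow> a x * c x = \<alpha>"
    by (rule pd_eq_0_imp_constant[OF open_U connected_U, rotated])
       (auto intro!: derivative_intros diff0)
  with that show ?thesis by blast
qed

text \<open>The Killing equations give \<open>d(v\<^sup>2 a + u\<^sup>2 c) = K d(u v)\<close> with \<open>K = v a\<^sub>u + u c\<^sub>v\<close>, which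
  avoids treating \<open>v\<^sup>2 a\<close> and \<open>u\<^sup>2 c\<close> as functions of \<open>u v\<close>: the level sets of \<open>u v\<close> in \<open>U\<close>
  need not be connected.\<close>

lemma sum_affine:
  obtains \<gamma> \<epsilon> where "\<And>x. x \<in> U \<Longrightarrow> x$2 * pd 1 a x + x$1 * pd 2 c x = \<gamma>"
    "\<And>x. x \<in> U \<Longrightarrow> x$2 * x$2 * a x + x$1 * x$1 * c x = \<gamma> * (x$1 * x$2) + \<epsilon>"
proof -
  let ?K = "\<lambda>x. x$2 * pd 1 a x + x$1 * pd 2 c x"
  have "pd 1 (pd 2 b) x = 0" if "x \<in> U" for x
    using pd_cong_open[OF open_U that, of "pd 2 b" "\<lambda>_. 0"] pd_b_eq_0 by simp
  then have lap: "pd 1 (pd 1 a) x + pd 2 (pd 2 c) x = 0" if "x \<in> U" for x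
    using curvature1[OF that] that by simp
  \<comment> \<open>By \<open>killing_pd\<close> the derivatives of \<open>?K\<close> are
    \<open>v (a_uu + c_vv)\<close> and \<open>u (a_uu + c_vv)\<close>.\<close>
  have dK: "pd k ?K x = 0" if x: "x \<in> U" for k x
  proof -
    have "pd 1 ?K x = 0"
      using killing_pd(2)[OF x] lap[OF x] x
      by (simp add: pd_rules derivative_intros) algebra
    moreover have "pd 2 ?K x = 0"
      using killing_pd(1)[OF x] lap[OF x] x
      by (simp add: pd_rules derivative_intros) algebra
    ultimately show ?thesis using exhaust_2[of k] by auto
  qed
  obtain \<gamma> where \<gamma>: "\<And>x. x \<in> U \<Longrightarrow> ?K x = \<gamma>"
    by (rule pd_eq_0_imp_constant[OF open_U connected_U _ dK])
       (auto intro!: derivative_intros diff1)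
  let ?S = "\<lambda>x. x$2 * x$2 * a x + x$1 * x$1 * c x - \<gamma> * (x$1 * x$2)"
  \<comment> \<open>By the Killing equations the derivatives of \<open>?S\<close> are
    \<open>v (?K - \<gamma>)\<close> and \<open>u (?K - \<gamma>)\<close>.\<close>
  have dS: "pd k ?S x = 0" if x: "x \<in> U" for k x
  proof -
    have "pd 1 ?S x = 0"
      using killing(3)[OF x] \<gamma>[OF x] x
      by (simp add: pd_rules derivative_intros) algebra
    moreover have "pd 2 ?S x = 0"
      using killing(1)[OF x] \<gamma>[OF x] x
      by (simp add: pd_rules derivative_intros) algebra
    ultimately show ?thesis using exhaust_2[of k] by auto
  qed
  obtain \<epsilon> where "\<And>x. x \<in> U \<Longrightarrow> ?S x = \<epsilon>"
    by (rule pd_eq_0_imp_constant[OF open_U connected_U _ dS])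
       (auto intro!: derivative_intros diff0)
  then show ?thesis using that[of \<gamma> \<epsilon>] \<gamma> by (simp add: algebra_simps)
qed

text \<open>If \<open>a\<close> and \<open>c\<close> were each nonzero somewhere, the closures of these two open sets would meet
  in \<open>U\<close>; at a common point both functions and their gradients vanish, so \<open>\<gamma> = \<epsilon> = 0\<close>.\<close>

lemma ac_zero_imp:
  assumes ac: "\<And>x. x \<in> U \<Longrightarrow> a x * c x = 0"
  shows "(\<forall>x\<in>U. a x = 0) \<or> (\<forall>x\<in>U. c x = 0)"
proof (rule ccontr)
  assume contra: "\<not> ?thesis"
  obtain \<gamma> \<epsilon> where \<gamma>: "\<And>x. x \<in> U \<Longrightarrow> x$2 * pd 1 a x + x$1 * pd 2 c x = \<gamma>"
    and \<epsilon>: "\<And>x. x \<in> U \<Longrightarrow> x$2 * x$2 * a x + x$1 * x$1 * c x = \<gamma> * (x$1 * x$2) + \<epsilon>"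
    using sum_affine by blast
  \<comment> \<open>If both constants vanished, \<open>v^2 a = - u^2 c\<close> and
    \<open>a c = 0\<close> would force \<open>a = 0\<close> off the axes, hence on
    \<open>U\<close>.\<close>
  have nz: "\<gamma> \<noteq> 0 \<or> \<epsilon> \<noteq> 0"
  proof (rule ccontr)
    assume "\<not> (\<gamma> \<noteq> 0 \<or> \<epsilon> \<noteq> 0)"
    then have S: "x$2 * x$2 * a x + x$1 * x$1 * c x = 0" if "x \<in> U" for x
      using \<epsilon>[OF that] by simp
    have "a x = 0" if "x \<in> U" for x
    proof (rule zero_off_axes_imp_zero[OF open_U cont0(1) that])
      fix y assume y: "y \<in> U" "y$1 \<noteq> 0" "y$2 \<noteq> 0"
      then show "a y = 0" using S[OF y(1)] ac[OF y(1)] by auto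
    qed
    with contra show False by blast
  qed
  define Wa Wc where "Wa = {x \<in> U. a x \<noteq> 0}" and "Wc = {x \<in> U. c x \<noteq> 0}"
  have open_W: "open Wa" "open Wc"
    using continuous_open_preimage[OF cont0(1) open_U, of "- {0}"]
      continuous_open_preimage[OF cont0(3) open_U, of "- {0}"]
    by (simp_all add: Wa_def Wc_def vimage_def Int_def open_Compl)
  have degenerate: False if "x \<in> U" "a x = 0" "c x = 0" "pd 1 a x = 0" "pd 2 c x = 0" for x
    using \<gamma>[OF that(1)] \<epsilon>[OF that(1)] that nz by simp
  \<comment> \<open>Off both closures \<open>a\<close> and \<open>c\<close> vanish on an open set,
    so their gradients vanish as well, contrary to \<open>degenerate\<close>.\<close>
  have "U \<subseteq> closure Wa \<union> closure Wc"
  proof (rule ccontr)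
    let ?Z = "U - closure Wa - closure Wc"
    assume "\<not> U \<subseteq> closure Wa \<union> closure Wc"
    then obtain z where z: "z \<in> ?Z" by blast
    have "open ?Z" using open_U by (intro open_Diff closed_closure)
    moreover have "a y = 0" "c y = 0" if "y \<in> ?Z" for y
      using that closure_subset[of Wa] closure_subset[of Wc] by (auto simp: Wa_def Wc_def)
    ultimately have "a z = 0" "c z = 0" "pd 1 a z = 0" "pd 2 c z = 0"
      using z pd_cong_open[of ?Z z a "\<lambda>_. 0"] pd_cong_open[of ?Z z c "\<lambda>_. 0"] by simp_all
    with z degenerate show False by blast
  qed
  moreover have "closure Wa \<inter> U \<noteq> {}" "closure Wc \<inter> U \<noteq> {}"
    using contra closure_subset[of Wa] closure_subset[of Wc] by (auto simp: Wa_def Wc_def)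
  \<comment> \<open>By connectedness, two closed sets that cover \<open>U\<close> and both meet it
    have a common point in \<open>U\<close>.\<close>
  ultimately obtain z where z: "z \<in> U" "z \<in> closure Wa" "z \<in> closure Wc"
    using connected_U unfolding connected_closed
    by (metis (no_types, lifting) IntE closed_closure ex_in_conv)
  have a0: "a y = 0" if "y \<in> Wc" for y using that ac[of y] by (auto simp: Wc_def)
  have c0: "c y = 0" if "y \<in> Wa" for y using that ac[of y] by (auto simp: Wa_def)
  have "pd 1 a y = 0" if "y \<in> Wc" for y
    using pd_cong_open[OF open_W(2) that, of a "\<lambda>_. 0"] a0 by simp
  then have "a z = 0" "pd 1 a z = 0"
    using zero_on_closure[OF open_U _ _ z(1,3)] a0 cont0(1) cont1(1) by blast+
  moreover have "pd 2 c y = 0" if "y \<in> Wa" for y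
    using pd_cong_open[OF open_W(1) that, of c "\<lambda>_. 0"] c0 by simp
  then have "c z = 0" "pd 2 c z = 0"
    using zero_on_closure[OF open_U _ _ z(1,2)] c0 cont0(3) cont1(3) by blast+
  ultimately show False using degenerate z(1) by blast
qed

end

section \<open>Reading off the canonical forms\<close>

lemma rescale_1: "rescale 1 = id"
  by (simp add: rescale_def fun_eq_iff vec_eq_iff)

lemma rescale_metric_1: "rescale_metric 1 g = g"
  by (simp add: rescale_metric_def fun_eq_iff vec_eq_iff)

lemma pencil_eqs_imp_g7_or_g9:
  fixes U :: "(real^2) set" and G :: "real^2 \<Rightarrow> real^2^2"
  assumes eqs: "pencil_eqs U (\<lambda>x. G x $ 1 $ 1) (\<lambda>x. G x $ 1 $ 2) (\<lambda>x. G x $ 2 $ 2)"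
    and sym: "\<And>x. x \<in> U \<Longrightarrow> G x $ 2 $ 1 = G x $ 1 $ 2"
  shows "is_g7_on U G \<or> is_g9_on U G"
proof (cases "U = {}")
  \<comment> \<open>Below, \<open>\<alpha> \<noteq> \<beta>^2\<close> is obtained from nondegeneracy
    at a point of \<open>U\<close>; without points, \<open>g7\<close> with all parameters 1 will
    do.\<close>
  case True
  then show ?thesis by (auto simp: is_g7_on_def intro!: exI[of _ "1::real"])
next
  case False
  then obtain p where p: "p \<in> U" by blast
  let ?a = "\<lambda>x. G x $ 1 $ 1" and ?b = "\<lambda>x. G x $ 1 $ 2" and ?c = "\<lambda>x. G x $ 2 $ 2"
  interpret pencil_eqs U ?a ?b ?c by (rule eqs)
  obtain \<beta> where \<beta>: "\<And>x. x \<in> U \<Longrightarrow> ?b x = \<beta>" using b_constant by blast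
  obtain \<alpha> where \<alpha>: "\<And>x. x \<in> U \<Longrightarrow> ?a x * ?c x = \<alpha>" using ac_constant by blast
  obtain \<gamma> \<epsilon> where \<epsilon>: "\<And>x. x \<in> U \<Longrightarrow> x$2 * x$2 * ?a x + x$1 * x$1 * ?c x = \<gamma> * (x$1 * x$2) + \<epsilon>"
    using sum_affine by metis
  have \<alpha>\<beta>: "\<alpha> \<noteq> \<beta>\<^sup>2" using nondeg[OF p] \<alpha>[OF p] \<beta>[OF p] by simp
  show ?thesis
  proof (cases "\<alpha> = 0 \<and> (\<forall>x\<in>U. ?c x = 0)")
    case True
    have "G x = g7 \<gamma> \<beta> \<epsilon> x" if x: "x \<in> U" and nz: "x$2 \<noteq> 0" for x
    proof -
      have "?a x = (\<gamma> * x$1 * x$2 + \<epsilon>) / (x$2)\<^sup>2"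
        using \<epsilon>[OF x] True x nz by (simp add: field_simps power2_eq_square)
      then show ?thesis
        using True x by (simp add: g7_def Let_def vec_eq_iff forall_2 sym \<beta>)
    qed
    moreover have "\<beta> \<noteq> 0" using True \<alpha>\<beta> by simp
    ultimately show ?thesis unfolding is_g7_on_def by blast
  next
    case False
    \<comment> \<open>Here \<open>\<alpha> = 0\<close> implies that \<open>c\<close> is not
      identically zero, so \<open>ac_zero_imp\<close> leaves only \<open>a = 0\<close>.\<close>
    then have a0: "?a x = 0" if "\<alpha> = 0" "x \<in> U" for x
      using ac_zero_imp \<alpha> that by auto
    \<comment> \<open>The sign selects the root: with it \<open>F9\<close> becomes \<open>c\<close>,
      while \<open>- R\<close> would give \<open>v^2 a / u^2\<close>.\<close>
    define R where "R = (\<lambda>x::real^2. x$1 * x$1 * ?c x - x$2 * x$2 * ?a x)"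
    have "smooth_on U R"
      unfolding R_def
      by (intro smooth_on_diff smooth_on_mult smooth_on_vec_nth smooth_abc open_U)
    moreover have "(R x)\<^sup>2 = radicand \<alpha> \<gamma> \<epsilon> x" if "x \<in> U" for x
    proof -
      have "radicand \<alpha> \<gamma> \<epsilon> x = (\<gamma> * (x$1 * x$2) + \<epsilon>)\<^sup>2 - 4 * \<alpha> * (x$1 * x$2)\<^sup>2"
        by (simp add: radicand_def Let_def power2_eq_square algebra_simps)
      then show ?thesis
        unfolding \<epsilon>[OF that, symmetric] \<alpha>[OF that, symmetric] R_def
        by (simp add: power2_eq_square algebra_simps)
    qed
    moreover have "G x = g9 \<alpha> \<beta> \<gamma> \<epsilon> R x" if x: "x \<in> U" and nz: "x$1 \<noteq> 0" for x
    proof -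
      have "\<gamma> * x$1 * x$2 + \<epsilon> + R x = ?c x * (2 * (x$1)\<^sup>2)"
        using \<epsilon>[OF x] unfolding R_def by (simp add: power2_eq_square algebra_simps)
      then have F: "F9 \<gamma> \<epsilon> R x = ?c x"
        using nz by (simp add: F9_def Let_def)
      \<comment> \<open>For \<open>\<alpha> = 0\<close> both sides are 0, also at zeros of
        \<open>c\<close> since \<open>0 / 0 = 0\<close>; for \<open>\<alpha> \<noteq> 0\<close> the
        product \<open>a c = \<alpha>\<close> keeps \<open>c\<close> nonzero.\<close>
      have "\<alpha> / ?c x = ?a x"
        using \<alpha>[OF x] a0[OF _ x] by (cases "\<alpha> = 0") (auto simp: field_simps)
      then show ?thesis
        using x by (simp add: g9_def vec_eq_iff forall_2 sym \<beta> F)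
    qed
    ultimately show ?thesis
      using \<alpha>\<beta> unfolding is_g9_on_def sqrt_branch_on_def by blast
  qed
qed

theorem theorem5:
  fixes U :: "(real^2) set" and B :: "2 nonlocal_op"
  assumes "open U" and "connected U"
    and "\<forall>i j. smooth_on U (\<lambda>x. lead B x $ i $ j)"
    and "\<forall>i j k. smooth_on U (conn B i j k)"
    and "\<forall>x\<in>U. det (lead B x) \<noteq> 0"
    and "kap B \<noteq> 0"
    and "tail B = hyp_rot"
    and "bihamiltonian_on U A_op B"
  shows "\<exists>c :: real^2. c$1 \<noteq> 0 \<and> c$2 \<noteq> 0 \<and>
    (is_g7_on (rescale c ` U) (rescale_metric c (lead B)) \<or>
     is_g8_on (rescale c ` U) (rescale_metric c (lead B)) \<or>
     is_g9_on (rescale c ` U) (rescale_metric c (lead B)))"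
  using pencil_eqs_imp_g7_or_g9[OF bihamiltonian_imp_pencil_eqs[OF assms]]
  by (intro exI[of _ "1::real^2"]) (auto simp: rescale_1 rescale_metric_1)

end
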